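(* Let $H$ be a real Hilbert space with unit sphere $S_H=\{x\in H : \|x\|=1\}$ equipped with the metric $d(x,y)=\arccos\langle x,y\rangle$. Let $C$ be a closed convex subset of $S_H$ such that $d(v,v')<\pi/2$ for every $v,v'\in C$. Let $r\ge 1$ be an integer, let $0<a<1/2$, and let $\alpha_{n,1},\alpha_{n,2},\ldots,\alpha_{n,r}$ ($n\in\mathbb{N}$) be real numbers such that $\alpha_{n,i}\in[a,1-a]$ for every $n\in\mathbb{N}$ and every $i=1,2,\ldots,r$. Let $T_1,T_2,\ldots,T_r$ be nonexpansive mappings of $C$ into itself such that $F:=\bigcap_{i=1}^r F(T_i)\neq\emptyset$. For each $n\in\mathbb{N}$ let $W_n$ be the $W$-mapping of $C$ into itself generated by $T_1,T_2,\ldots,T_r$ and $\alpha_{n,1},\alpha_{n,2},\ldots,\alpha_{n,r}$. For a given point $x_1\in C$, let $\{x_n\}$ be the sequence in $C$ generated by \begin{align*} y_n &:= W_nx_n,\\ C_n &:= \{z\in C : d(y_n,z)\leq d(x_n,z)\},\\ Q_n &:= \{z\in C : \cos d(x_1,x_n)\cos d(x_n,z)\geq \cos d(x_1,z)\},\\ x_{n+1} &:= P_{C_n\cap Q_n}x_1 \end{align*} for all $n\in\mathbb{N}$. Then $\{x_n\}$ is well defined and converges (in the metric $d$) to $P_Fx_1$.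
   Context: $\mathbb{N}=\{1,2,3,\ldots\}$. Geodesics and convexity: for $x,y\in S_H$ with $d(x,y)<\pi$ there is a unique geodesic segment $[x,y]$ in $S_H$ joining $x$ to $y$ (the shorter great-circle arc). A subset $C\subset S_H$ all of whose pairs of points are at distance less than $\pi/2$ is convex if $[x,y]\subset C$ for all $x,y\in C$. For $\alpha\in[0,1]$, $\alpha x\oplus(1-\alpha)y$ denotes the unique point $z\in[x,y]$ with $d(y,z)=\alpha d(x,y)$ and $d(x,z)=(1-\alpha)d(x,y)$. Mappings: $T:C\to C$ is nonexpansive if $d(Tx,Ty)\le d(x,y)$ for all $x,y\in C$; $F(T)=\{z\in C : Tz=z\}$ is its fixed point set; $I$ is the identity mapping. $W$-mapping: given mappings $T_1,\ldots,T_r$ of $C$ into itself and real numbers $\alpha_1,\ldots,\alpha_r\in[0,1]$, define inductively (pointwise) $U_1:=\alpha_1T_1\oplus(1-\alpha_1)I$, and $U_k:=\alpha_kT_kU_{k-1}\oplus(1-\alpha_k)I$ for $k=2,\ldots,r$. The mapping $W:=U_r$ is called the $W$-mapping generated by $T_1,\ldots,T_r$ and $\alpha_1,\ldots,\alpha_r$. Metric projection: for a nonempty closed convex subset $K$ of $C$ and $x\in C$, $P_Kx$ denotes the unique point of $K$ with $d(x,P_Kx)=\inf_{y\in K}d(x,y)$. (The fixed point set of a nonexpansive mapping of $C$ into itself is closed and convex, so $P_F$ makes sense.) "Well defined" means that at each step the set $C_n\cap Q_n$ is a nonempty closed convex subset of $C$, so that the projection defining $x_{n+1}$ exists. *)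

theory Defs
  imports "HOL-Analysis.Analysis"
begin

section \<open>The metric of the unit sphere\<close>

text \<open>
  Outside the unit sphere the value is irrelevant; it is set to 0 because \<^locale>\<open>Metric_space\<close>
  demands nonnegativity and symmetry on the whole type.
\<close>

definition sdist :: "'a::real_inner \<Rightarrow> 'a \<Rightarrow> real" where
  "sdist x y = (if x \<in> sphere 0 1 \<and> y \<in> sphere 0 1 then arccos (x \<bullet> y) else 0)"

lemma inner_sphere_bounds:
  fixes x y :: "'a::real_inner"
  assumes "x \<in> sphere 0 1" "y \<in> sphere 0 1"
  shows "\<bar>x \<bullet> y\<bar> \<le> 1" "- 1 \<le> x \<bullet> y" "x \<bullet> y \<le> 1"
proof -
  show "\<bar>x \<bullet> y\<bar> \<le> 1" using Cauchy_Schwarz_ineq2[of x y] assms by simp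
  then show "- 1 \<le> x \<bullet> y" "x \<bullet> y \<le> 1" by auto
qed

lemma sdist_eq: "x \<in> sphere 0 1 \<Longrightarrow> y \<in> sphere 0 1 \<Longrightarrow> sdist x y = arccos (x \<bullet> y)"
  by (simp add: sdist_def)

lemma cos_sdist: "x \<in> sphere 0 1 \<Longrightarrow> y \<in> sphere 0 1 \<Longrightarrow> cos (sdist x y) = x \<bullet> y"
  using inner_sphere_bounds[of x y] by (simp add: sdist_eq)

lemma sdist_nonneg: "0 \<le> sdist x y"
  using inner_sphere_bounds[of x y] by (auto simp: sdist_def arccos_lbound)

lemma sdist_le_pi: "sdist x y \<le> pi"
  using inner_sphere_bounds[of x y] by (auto simp: sdist_def arccos_ubound)

lemma sdist_commute: "sdist x y = sdist y x"
  by (simp add: sdist_def inner_commute)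

lemma sphere_inner_self: "x \<in> sphere 0 1 \<Longrightarrow> x \<bullet> x = 1"
  by (simp add: norm_eq_1)

lemma sphere_inner_eq_1:
  fixes x y :: "'a::real_inner"
  assumes "x \<in> sphere 0 1" "y \<in> sphere 0 1"
  shows "x \<bullet> y = 1 \<longleftrightarrow> x = y"
proof
  assume "x \<bullet> y = 1"
  then have "(x - y) \<bullet> (x - y) = 0"
    using assms by (simp add: inner_diff inner_commute sphere_inner_self)
  then show "x = y" by simp
qed (use assms sphere_inner_self in auto)

lemma sdist_triangle:
  fixes x y z :: "'a::real_inner"
  assumes x: "x \<in> sphere 0 1" and y: "y \<in> sphere 0 1" and z: "z \<in> sphere 0 1"
  shows "sdist x z \<le> sdist x y + sdist y z"
proof (cases "sdist x y + sdist y z \<le> pi")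
  case False
  then show ?thesis using sdist_le_pi[of x z] by linarith
next
  case True
  define p where "p = x - (x \<bullet> y) *\<^sub>R y"
  define q where "q = z - (y \<bullet> z) *\<^sub>R y"
  have sq: "sin (sdist u v) = sqrt (1 - (u \<bullet> v)\<^sup>2)"
    if "u \<in> sphere 0 1" "v \<in> sphere 0 1" for u v :: 'a
    using that inner_sphere_bounds[of u v] by (simp add: sdist_eq sin_arccos_abs)
  have "(norm p)\<^sup>2 = 1 - (x \<bullet> y)\<^sup>2" "(norm q)\<^sup>2 = 1 - (y \<bullet> z)\<^sup>2"
    unfolding p_def q_def power2_norm_eq_inner
    using sphere_inner_self[OF x] sphere_inner_self[OF y] sphere_inner_self[OF z]
    by (simp_all add: inner_diff inner_commute power2_eq_square)
  then have n: "norm p = sin (sdist x y)" "norm q = sin (sdist y z)"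
    by (metis norm_ge_zero real_sqrt_abs abs_of_nonneg sq x y z)+
  have "p \<bullet> q = x \<bullet> z - (x \<bullet> y) * (y \<bullet> z)"
    unfolding p_def q_def using sphere_inner_self[OF y]
    by (simp add: inner_diff inner_commute)
  moreover have "\<bar>p \<bullet> q\<bar> \<le> norm p * norm q" by (rule Cauchy_Schwarz_ineq2)
  ultimately have "cos (sdist x y + sdist y z) \<le> cos (sdist x z)"
    unfolding cos_add cos_sdist[OF x y] cos_sdist[OF y z] cos_sdist[OF x z] n[symmetric]
    by linarith
  then show ?thesis
    using True sdist_nonneg sdist_le_pi
    by (meson add_nonneg_nonneg cos_mono_le_eq)
qed

interpretation sph: Metric_space "sphere (0::'a::real_inner) 1" "sdist :: 'a \<Rightarrow> 'a \<Rightarrow> real"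
proof
  show "sdist x y = 0 \<longleftrightarrow> x = y" if "x \<in> sphere 0 1" "y \<in> sphere 0 1" for x y :: 'a
    using that inner_sphere_bounds[of x y] arccos_eq_0_iff[of "x \<bullet> y"] sphere_inner_eq_1
    by (auto simp: sdist_eq)
qed (auto simp: sdist_nonneg sdist_commute sdist_triangle)


section \<open>Geodesic segments, convexity, convex combinations\<close>

definition geodesic_between :: "(real \<Rightarrow> 'a::real_inner) \<Rightarrow> 'a \<Rightarrow> 'a \<Rightarrow> bool" where
  "geodesic_between c x y \<longleftrightarrow>
     c ` {0..sdist x y} \<subseteq> sphere 0 1 \<and> c 0 = x \<and> c (sdist x y) = y \<and>
     (\<forall>s\<in>{0..sdist x y}. \<forall>t\<in>{0..sdist x y}. sdist (c s) (c t) = \<bar>s - t\<bar>)"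

definition geodesic_segment :: "'a::real_inner \<Rightarrow> 'a \<Rightarrow> 'a set" where
  "geodesic_segment x y =
     (THE G. \<exists>c. geodesic_between c x y \<and> G = c ` {0..sdist x y})"

definition geodesically_convex :: "'a::real_inner set \<Rightarrow> bool" where
  "geodesically_convex C \<longleftrightarrow> (\<forall>x\<in>C. \<forall>y\<in>C. geodesic_segment x y \<subseteq> C)"

text \<open>\<open>gcomb \<alpha> x y\<close> is the point $\alpha x \oplus (1-\alpha) y$.\<close>

definition gcomb :: "real \<Rightarrow> 'a::real_inner \<Rightarrow> 'a \<Rightarrow> 'a" where
  "gcomb \<alpha> x y =
     (THE z. z \<in> geodesic_segment x y \<and>
             sdist y z = \<alpha> * sdist x y \<and> sdist x z = (1 - \<alpha>) * sdist x y)"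

text \<open>The parametrised great circle arc; it shows that the two definite descriptions are proper.\<close>

definition arc_point :: "'a::real_inner \<Rightarrow> 'a \<Rightarrow> real \<Rightarrow> 'a" where
  "arc_point x y t =
     (if x = y then x
      else (sin (sdist x y - t) / sin (sdist x y)) *\<^sub>R x + (sin t / sin (sdist x y)) *\<^sub>R y)"

lemma sin_sdist_pos:
  assumes "x \<in> sphere 0 1" "y \<in> sphere 0 1" "x \<noteq> y" "sdist x y < pi"
  shows "sin (sdist x y) > 0"
  using assms by (intro sin_gt_zero) auto

lemma arc_point_inner:
  fixes x y :: "'a::real_inner"
  assumes xy: "x \<in> sphere 0 1" "y \<in> sphere 0 1" "x \<noteq> y" "sdist x y < pi"
  shows "arc_point x y s \<bullet> arc_point x y t = cos (s - t)"
proof -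
  define l where "l = sdist x y"
  have sl: "sin l > 0" using sin_sdist_pos[OF xy] by (simp add: l_def)
  have i: "x \<bullet> x = 1" "y \<bullet> y = 1" "x \<bullet> y = cos l" "y \<bullet> x = cos l"
    using xy by (simp_all add: l_def cos_sdist inner_commute sphere_inner_self)
  have a: "arc_point x y t = (sin (l - t) / sin l) *\<^sub>R x + (sin t / sin l) *\<^sub>R y" for t
    using xy by (simp add: arc_point_def l_def)
  have "arc_point x y s \<bullet> arc_point x y t * (sin l)\<^sup>2 =
      sin (l - s) * sin (l - t) + sin s * sin t + (sin (l - s) * sin t + sin s * sin (l - t)) * cos l"
    unfolding a using sl by (simp add: inner_add i field_simps power2_eq_square)
  also have "\<dots> = cos (s - t) * (sin l)\<^sup>2"
  proof -
    have c: "(cos l)\<^sup>2 = 1 - (sin l)\<^sup>2" by (simp add: cos_squared_eq)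
    show ?thesis unfolding sin_diff cos_diff using c by algebra
  qed
  finally show ?thesis using sl by simp
qed

lemma arc_point_sphere:
  fixes x y :: "'a::real_inner"
  assumes "x \<in> sphere 0 1" "y \<in> sphere 0 1" "sdist x y < pi"
  shows "arc_point x y t \<in> sphere 0 1"
  using arc_point_inner[of x y t t] assms
  by (cases "x = y") (auto simp: norm_eq_1 arc_point_def)

lemma arc_point_ends:
  assumes "x \<in> sphere 0 1" "y \<in> sphere 0 1" "sdist x y < pi"
  shows "arc_point x y 0 = x" "arc_point x y (sdist x y) = y"
  using sin_sdist_pos[of x y] assms by (auto simp: arc_point_def)

lemma arc_point_sdist:
  fixes x y :: "'a::real_inner"
  assumes xy: "x \<in> sphere 0 1" "y \<in> sphere 0 1" "sdist x y < pi"
    and st: "s \<in> {0..sdist x y}" "t \<in> {0..sdist x y}"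
  shows "sdist (arc_point x y s) (arc_point x y t) = \<bar>s - t\<bar>"
proof (cases "x = y")
  case True
  then show ?thesis using st xy by (auto simp: arc_point_def)
next
  case False
  have "sdist (arc_point x y s) (arc_point x y t) = arccos (cos (s - t))"
    using arc_point_inner[of x y s t] arc_point_sphere[of x y] xy False by (simp add: sdist_eq)
  also have "\<dots> = \<bar>s - t\<bar>"
    using st xy(3) by (intro arccos_cos_eq_abs) auto
  finally show ?thesis .
qed

lemma arc_point_unique:
  fixes x y z :: "'a::real_inner"
  assumes xy: "x \<in> sphere 0 1" "y \<in> sphere 0 1" "sdist x y < pi" and z: "z \<in> sphere 0 1"
    and d: "sdist x z = t" "sdist y z = sdist x y - t"
  shows "z = arc_point x y t"
proof (cases "x = y")
  case True
  then have "t = 0" using d xy by simp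
  then show ?thesis using True d xy z by (simp add: arc_point_def)
next
  case False
  define l where "l = sdist x y"
  have sl: "sin l > 0" using sin_sdist_pos[of x y] xy False by (simp add: l_def)
  have i: "x \<bullet> z = cos t" "y \<bullet> z = cos (l - t)"
    using cos_sdist[OF xy(1) z] cos_sdist[OF xy(2) z] by (simp_all add: l_def d)
  have "(arc_point x y t \<bullet> z) * sin l = sin (l - t) * cos t + sin t * cos (l - t)"
    using False sl by (simp add: arc_point_def l_def[symmetric] inner_add i field_simps)
  also have "\<dots> = sin l" using sin_add[of "l - t" t] unfolding diff_add_cancel by (simp only: mult.commute)
  finally have "arc_point x y t \<bullet> z = 1" using sl by simp
  then show ?thesis using sphere_inner_eq_1[OF arc_point_sphere[OF xy] z] by simp
qed

lemma geodesic_between_arc_point: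
  assumes "x \<in> sphere 0 1" "y \<in> sphere 0 1" "sdist x y < pi"
  shows "geodesic_between (arc_point x y) x y"
  using arc_point_sphere[OF assms] arc_point_ends[OF assms] arc_point_sdist[OF assms]
  unfolding geodesic_between_def by blast

lemma geodesic_between_unique:
  assumes xy: "x \<in> sphere 0 1" "y \<in> sphere 0 1" "sdist x y < pi"
    and c: "geodesic_between c x y" and t: "t \<in> {0..sdist x y}"
  shows "c t = arc_point x y t"
proof -
  have l: "0 \<in> {0..sdist x y}" "sdist x y \<in> {0..sdist x y}"
    using sdist_nonneg[of x y] by auto
  have c0: "c 0 = x" "c (sdist x y) = y" "c t \<in> sphere 0 1"
    using c t unfolding geodesic_between_def by blast+
  have "sdist (c 0) (c t) = \<bar>0 - t\<bar>" "sdist (c (sdist x y)) (c t) = \<bar>sdist x y - t\<bar>"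
    using c t l unfolding geodesic_between_def by blast+
  then show ?thesis using xy t c0 by (intro arc_point_unique) auto
qed

lemma geodesic_segment_eq:
  assumes "x \<in> sphere 0 1" "y \<in> sphere 0 1" "sdist x y < pi"
  shows "geodesic_segment x y = arc_point x y ` {0..sdist x y}"
  unfolding geodesic_segment_def
proof (rule the_equality)
  show "\<exists>c. geodesic_between c x y \<and> arc_point x y ` {0..sdist x y} = c ` {0..sdist x y}"
    using geodesic_between_arc_point[OF assms] by blast
  show "G = arc_point x y ` {0..sdist x y}"
    if "\<exists>c. geodesic_between c x y \<and> G = c ` {0..sdist x y}" for G
    using that geodesic_between_unique[OF assms] by auto
qed

lemma gcomb_eq:
  assumes xy: "x \<in> sphere 0 1" "y \<in> sphere 0 1" "sdist x y < pi" and a: "\<alpha> \<in> {0..1}"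
  shows "gcomb \<alpha> x y = arc_point x y ((1 - \<alpha>) * sdist x y)"
  unfolding gcomb_def
proof (rule the_equality)
  let ?l = "sdist x y" and ?t = "(1 - \<alpha>) * sdist x y"
  have t: "?t \<in> {0..?l}" "0 \<in> {0..?l}" "?l \<in> {0..?l}"
    using a sdist_nonneg[of x y] by (auto simp: mult_left_le_one_le)
  have "?l - ?t = \<alpha> * ?l" by (simp add: algebra_simps)
  moreover have "0 \<le> \<alpha> * ?l" using a sdist_nonneg[of x y] by simp
  ultimately have "\<bar>?l - ?t\<bar> = \<alpha> * ?l" "\<bar>0 - ?t\<bar> = ?t"
    using t(1) by auto
  then show "arc_point x y ?t \<in> geodesic_segment x y \<and>
      sdist y (arc_point x y ?t) = \<alpha> * ?l \<and> sdist x (arc_point x y ?t) = ?t"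
    using arc_point_sdist[OF xy t(2,1)] arc_point_sdist[OF xy t(3,1)] t(1)
    by (simp only: arc_point_ends[OF xy] geodesic_segment_eq[OF xy]) auto
  show "z = arc_point x y ?t"
    if "z \<in> geodesic_segment x y \<and> sdist y z = \<alpha> * ?l \<and> sdist x z = ?t" for z
    using that arc_point_sphere[OF xy] geodesic_segment_eq[OF xy]
    by (intro arc_point_unique[OF xy]) (auto simp: algebra_simps)
qed


section \<open>Mappings\<close>

definition nonexpansive_on :: "'a::real_inner set \<Rightarrow> ('a \<Rightarrow> 'a) \<Rightarrow> bool" where
  "nonexpansive_on C T \<longleftrightarrow> (\<forall>x\<in>C. \<forall>y\<in>C. sdist (T x) (T y) \<le> sdist x y)"

definition Fix :: "'a set \<Rightarrow> ('a \<Rightarrow> 'a) \<Rightarrow> 'a set" where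
  "Fix C T = {z \<in> C. T z = z}"

text \<open>
  \<open>W_map T \<alpha> k\<close> is $U_k$, so the $W$-mapping generated by $T_1,\dots,T_r$ and
  $\alpha_1,\dots,\alpha_r$ is \<open>W_map T \<alpha> r\<close>. Setting $U_0 = I$ merges the clause for $U_1$ with the
  general one.
\<close>

primrec W_map :: "(nat \<Rightarrow> 'a::real_inner \<Rightarrow> 'a) \<Rightarrow> (nat \<Rightarrow> real) \<Rightarrow> nat \<Rightarrow> 'a \<Rightarrow> 'a" where
  "W_map T \<alpha> 0 = (\<lambda>z. z)"
| "W_map T \<alpha> (Suc k) = (\<lambda>z. gcomb (\<alpha> (Suc k)) (T (Suc k) (W_map T \<alpha> k z)) z)"

lemma W_map_1: "W_map T \<alpha> 1 = (\<lambda>z. gcomb (\<alpha> 1) (T 1 z) z)"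
  by simp


section \<open>Metric projection\<close>

definition metric_proj :: "'a::real_inner set \<Rightarrow> 'a \<Rightarrow> 'a" where
  "metric_proj K x = (THE p. p \<in> K \<and> sdist x p = (INF y\<in>K. sdist x y))"

lemma closedin_sph_iff: "closedin sph.mtopology C \<longleftrightarrow> C \<subseteq> sphere 0 1 \<and> closed C"
proof
  assume C: "closedin sph.mtopology C"
  then have sub: "C \<subseteq> sphere 0 1" using closedin_subset sph.topspace_mtopology by blast
  have "l \<in> C" if f: "\<forall>n. f n \<in> C" and lim: "f \<longlonglongrightarrow> l" for f l
  proof -
    have fs: "f n \<in> sphere 0 1" for n using f sub by blast
    have l: "l \<in> sphere 0 1"
      using tendsto_norm[OF lim] fs by (simp add: LIMSEQ_const_iff)
    have "(\<lambda>n. f n \<bullet> l) \<longlonglongrightarrow> l \<bullet> l" by (intro tendsto_intros lim)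
    then have "(\<lambda>n. arccos (f n \<bullet> l)) \<longlonglongrightarrow> arccos 1"
      using inner_sphere_bounds[OF fs l] sphere_inner_self[OF l]
      by (intro continuous_on_tendsto_compose[OF continuous_on_arccos']) auto
    then have "(\<lambda>n. sdist (f n) l) \<longlonglongrightarrow> 0" using fs l by (simp add: sdist_eq)
    then have "limitin sph.mtopology f l sequentially"
      using fs l by (simp add: sph.limitin_metric_dist_null)
    then show ?thesis using limitin_closedin[OF _ C] f by fastforce
  qed
  then show "C \<subseteq> sphere 0 1 \<and> closed C" using sub by (auto simp: closed_sequential_limits)
next
  assume C: "C \<subseteq> sphere 0 1 \<and> closed C"
  show "closedin sph.mtopology C"
    unfolding sph.metric_closedin_iff_sequentially_closed
  proof (intro conjI allI impI)
    fix \<sigma> l assume a: "range \<sigma> \<subseteq> C \<and> limitin sph.mtopology \<sigma> l sequentially"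
    have l: "l \<in> sphere 0 1" using a sph.limitin_mspace by blast
    have fs: "\<sigma> n \<in> sphere 0 1" for n using a C by blast
    have "(\<lambda>n. sdist (\<sigma> n) l) \<longlonglongrightarrow> 0" using a by (simp add: sph.limitin_metric_dist_null)
    then have "(\<lambda>n. cos (sdist (\<sigma> n) l)) \<longlonglongrightarrow> cos 0" by (intro tendsto_intros)
    then have "(\<lambda>n. \<sigma> n \<bullet> l) \<longlonglongrightarrow> 1" using fs l by (simp add: cos_sdist)
    then have "(\<lambda>n. sqrt (2 - 2 * (\<sigma> n \<bullet> l))) \<longlonglongrightarrow> sqrt (2 - 2 * 1)" by (intro tendsto_intros)
    moreover have "norm (\<sigma> n - l) = sqrt (2 - 2 * (\<sigma> n \<bullet> l))" for n
      using sphere_inner_self[OF fs[of n]] sphere_inner_self[OF l]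
      by (simp add: norm_eq_sqrt_inner inner_diff inner_commute)
    ultimately have "(\<lambda>n. norm (\<sigma> n - l)) \<longlonglongrightarrow> 0" by simp
    then have "\<sigma> \<longlonglongrightarrow> l" by (simp only: tendsto_norm_zero_iff LIM_zero_iff)
    then show "l \<in> C" using C a by (metis closed_sequentially range_subsetD)
  qed (use C in auto)
qed

lemma arc_point_midpoint:
  fixes x y :: "'a::real_inner"
  assumes xy: "x \<in> sphere 0 1" "y \<in> sphere 0 1" "sdist x y < pi"
  shows "norm (x + y) *\<^sub>R arc_point x y (sdist x y / 2) = x + y"
proof (cases "x = y")
  case True
  then show ?thesis using xy by (simp add: arc_point_def flip: scaleR_2)
next
  case False
  define h where "h = sdist x y / 2"
  have "h > 0" "h < pi / 2"
    using False xy sph.mdist_pos_less[of x y] by (auto simp: h_def)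
  then have p: "cos h > 0" "sin h > 0" by (auto intro: cos_gt_zero sin_gt_zero)
  have "(norm (x + y))\<^sup>2 = 2 + 2 * cos (2 * h)"
    using sphere_inner_self[OF xy(1)] sphere_inner_self[OF xy(2)] cos_sdist[OF xy(1,2)]
    by (simp add: power2_norm_eq_inner inner_add inner_commute h_def)
  also have "\<dots> = (2 * cos h)\<^sup>2" by (simp add: cos_double_cos power_mult_distrib)
  finally have "norm (x + y) = 2 * cos h" by (rule power2_eq_imp_eq) (use p in auto)
  moreover have "sdist x y = 2 * h" by (simp add: h_def)
  ultimately show ?thesis
    using False p by (simp add: arc_point_def sin_double scaleR_add_right)
qed

lemma metric_proj_unique_existence:
  fixes K :: "'a::{real_inner, complete_space} set"
  assumes K: "closedin sph.mtopology K" "geodesically_convex K" "K \<noteq> {}"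
    and KK: "\<And>y z. y \<in> K \<Longrightarrow> z \<in> K \<Longrightarrow> sdist y z < pi / 2"
    and x: "x \<in> sphere 0 1" and xK: "\<And>z. z \<in> K \<Longrightarrow> sdist x z < pi / 2"
  shows "\<exists>!p. p \<in> K \<and> sdist x p = (INF y\<in>K. sdist x y)"
proof -
  have sub: "K \<subseteq> sphere 0 1" and cl: "closed K" using K(1) closedin_sph_iff by auto
  define s where "s = (SUP y\<in>K. x \<bullet> y)"
  have bdd: "bdd_above ((\<bullet>) x ` K)"
    using inner_sphere_bounds(3)[OF x] sub by (intro bdd_aboveI[of _ 1]) auto
  have le_s: "x \<bullet> z \<le> s" if "z \<in> K" for z
    unfolding s_def using bdd that by (intro cSUP_upper) auto
  obtain z0 where z0: "z0 \<in> K" using K by blast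
  have "x \<bullet> z0 > 0"
    using cos_sdist[OF x, of z0] z0 sub xK[OF z0] sdist_nonneg[of x z0]
    by (metis cos_gt_zero_pi minus_less_iff less_le_trans neg_less_0_iff_less pi_half_gt_zero subsetD)
  then have s0: "s > 0" using le_s[OF z0] by linarith
  \<comment> \<open>the midpoint of two points of \<open>K\<close> lies in \<open>K\<close>\<close>
  have mid: "x \<bullet> (y + z) \<le> s * norm (y + z)" if yz: "y \<in> K" "z \<in> K" for y z
  proof -
    have ys: "y \<in> sphere 0 1" "z \<in> sphere 0 1" "sdist y z < pi"
      using yz sub KK[OF yz] pi_gt_zero by (blast, blast, linarith)
    have "arc_point y z (sdist y z / 2) \<in> K"
      using K(2) yz geodesic_segment_eq[OF ys] sdist_nonneg[of y z]
      unfolding geodesically_convex_def by fastforce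
    from le_s[OF this] have "norm (y + z) * (x \<bullet> arc_point y z (sdist y z / 2)) \<le> norm (y + z) * s"
      by (intro mult_left_mono) auto
    then show ?thesis by (metis arc_point_midpoint[OF ys] inner_scaleR_right mult.commute)
  qed
  have close: "(norm (y - z))\<^sup>2 \<le> 8 * e / s"
    if yz: "y \<in> K" "z \<in> K" and e: "e \<ge> 0" "x \<bullet> y \<ge> s - e" "x \<bullet> z \<ge> s - e" for y z e
  proof -
    have n: "norm y = 1" "norm z = 1" using yz sub by auto
    define u where "u = norm (y + z)"
    have "2 * s - 2 * e \<le> s * u" using mid[OF yz] e by (simp add: inner_add_right u_def)
    then have u: "s * (2 - u) \<le> 2 * e" by (simp add: algebra_simps)
    have u2: "0 \<le> u" "u \<le> 2" using norm_triangle_ineq[of y z] n by (auto simp: u_def)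
    have "(norm (y - z))\<^sup>2 = 4 - u\<^sup>2"
      unfolding u_def power2_norm_eq_inner
      using sphere_inner_self[of y] sphere_inner_self[of z] yz sub
      by (simp add: inner_add inner_diff inner_commute subset_iff)
    also have "\<dots> = (2 - u) * (2 + u)" by (simp add: algebra_simps power2_eq_square)
    also have "\<dots> \<le> (2 - u) * 4" using u2 by (intro mult_left_mono) auto
    finally have "s * (norm (y - z))\<^sup>2 \<le> s * ((2 - u) * 4)" using s0 by simp
    also have "\<dots> \<le> 8 * e" using u by (simp add: algebra_simps)
    finally show ?thesis using s0 by (simp add: field_simps)
  qed
  have "\<exists>z\<in>K. s - 1 / Suc n < x \<bullet> z" for n :: nat
    unfolding s_def using less_cSUP_iff[OF K(3) bdd, of "s - 1 / Suc n"] by (simp add: s_def)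
  then obtain f where f: "f n \<in> K" "s - 1 / Suc n < x \<bullet> f n" for n by metis
  have "Cauchy f"
  proof (rule CauchyI)
    fix e :: real assume e: "0 < e"
    then obtain M :: nat where M: "8 / (s * e\<^sup>2) < M" using reals_Archimedean2 by blast
    have "norm (f m - f n) < e" if mn: "M \<le> m" "M \<le> n" for m n
    proof -
      have "1 / real (Suc m) \<le> 1 / Suc M" "1 / real (Suc n) \<le> 1 / Suc M"
        using mn by (auto simp: field_simps)
      then have "(norm (f m - f n))\<^sup>2 \<le> 8 * (1 / Suc M) / s"
        using f[of m] f[of n] by (intro close) auto
      also have "\<dots> < e\<^sup>2"
      proof -
        have "8 / (s * e\<^sup>2) < Suc M" using M by simp
        then have "8 < e\<^sup>2 * (s * real (Suc M))"
          using s0 e by (simp add: pos_divide_less_eq mult_ac)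
        then have "8 / (s * real (Suc M)) < e\<^sup>2"
          using s0 by (simp add: pos_divide_less_eq)
        then show ?thesis by (simp add: mult.commute)
      qed
      finally show ?thesis using e by (simp add: power2_less_imp_less)
    qed
    then show "\<exists>M. \<forall>m\<ge>M. \<forall>n\<ge>M. norm (f m - f n) < e" by blast
  qed
  then obtain p where p: "f \<longlonglongrightarrow> p" using Cauchy_convergent_iff convergentD by blast
  have pK: "p \<in> K" using closed_sequentially[OF cl _ p] f by blast
  have "(\<lambda>n. x \<bullet> f n) \<longlonglongrightarrow> x \<bullet> p" by (intro tendsto_intros p)
  moreover have "(\<lambda>n. s - 1 / real (Suc n)) \<longlonglongrightarrow> s - 0"
    by (intro tendsto_diff tendsto_const LIMSEQ_Suc[OF lim_1_over_n])
  ultimately have "s \<le> x \<bullet> p"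
    using f(2) by (intro LIMSEQ_le[of "\<lambda>n. s - 1 / real (Suc n)"]) (auto intro: less_imp_le)
  then have ps: "x \<bullet> p = s" using le_s[OF pK] by simp
  have mono: "sdist x p \<le> sdist x z" if "z \<in> K" for z
    using le_s[OF that] ps that pK sub inner_sphere_bounds[OF x] x
    by (auto simp: sdist_eq subset_iff intro!: arccos_le_arccos)
  have inf: "(INF y\<in>K. sdist x y) = sdist x p"
    using mono pK by (intro cInf_eq_minimum) auto
  show ?thesis
  proof (rule ex1I[of _ p])
    show "p \<in> K \<and> sdist x p = (INF y\<in>K. sdist x y)" using pK inf by simp
    fix q assume q: "q \<in> K \<and> sdist x q = (INF y\<in>K. sdist x y)"
    then have "cos (sdist x q) = cos (sdist x p)" using inf by simp
    then have "x \<bullet> q = s" using q pK sub x ps by (metis cos_sdist subsetD)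
    then have "(norm (q - p))\<^sup>2 \<le> 8 * 0 / s" using q pK ps by (intro close) auto
    then show "q = p" by simp
  qed
qed

end

theory Submission
  imports Defs
begin

text \<open>
  Since $\cos d(u,v) = \langle u,v\rangle$ and all inner products of points of $C$ are positive, every
  condition of the theorem is a statement about inner products. Both $C_n$ and $Q_n$ are
  intersections of $C$ with half-spaces $\{z : \langle w,z\rangle \ge 0\}$, and so is the set of fixed
  points of a nonexpansive mapping (\<open>Fix_eq_halfspaces\<close>). Since an arc consists of nonnegative
  combinations of its ends, all these sets are closed and convex. The mapping $W_n$ does not
  move $x_n$ farther from any $z \in F$, so $F \subseteq C_n$; the projection $p = P_K x$ satisfies
  $\langle x,z\rangle \le \langle x,p\rangle\langle p,z\rangle$ for $z \in K$
  (\<open>metric_proj_variational\<close>), and with $K = C_n \cap Q_n$ this is $F \subseteq Q_{n+1}$. So the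
  sequence is well defined.

  Put $s_n = \langle x_1,x_n\rangle$. From $x_{n+1} \in Q_n$ comes
  $s_{n+1} \le s_n \langle x_n,x_{n+1}\rangle$, so $s_n$ decreases to a limit $l$. For $p = P_F x_1$,
  $p \in Q_n$ gives $\langle x_1,p\rangle \le s_n \langle x_n,p\rangle$, so
  $l \ge \langle x_1,p\rangle > 0$. Therefore $\langle x_n,x_{n+1}\rangle \to 1$, and
  $x_{n+1} \in C_n$ yields $y_n - x_n \to 0$. The strict gain of inner product in a convex combination
  (\<open>gcomb_inner_gain\<close>), read backwards through the $r$ stages of $W_n$, turns this into
  $T_i x_n - x_n \to 0$ for every $i$ (\<open>W_map_asymptotically_regular\<close>).

  To reach a common fixed point from here one would classically pass to a weak cluster point of
  $(x_n)$. A strong limit does the same job: the projections of $x_1$ onto the closed convex hulls of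
  the tails converge to a point $q$ that lies in all the hulls and satisfies
  $\langle x_1,q\rangle \ge l$ (\<open>tail_hull_point\<close>). Half-spaces that contain a tail contain
  $q$, and this is all that is needed to prove $T_i q = q$ (\<open>demiclosed\<close>). As $q \in F$ and $p$
  is the point of $F$ nearest to $x_1$, $l \le \langle x_1,q\rangle \le \langle x_1,p\rangle$. Now
  $\langle x_n,p\rangle \ge \langle x_1,p\rangle / s_n \to \langle x_1,p\rangle / l = 1$, which says that
  $x_n \to p$.
\<close>

section \<open>Distances as inner products\<close>

lemma sdist_le_iff:
  assumes "u \<in> sphere 0 1" "v \<in> sphere 0 1" "w \<in> sphere 0 1" "z \<in> sphere 0 1"
  shows "sdist u v \<le> sdist w z \<longleftrightarrow> w \<bullet> z \<le> u \<bullet> v"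
  using assms inner_sphere_bounds[of u v] inner_sphere_bounds[of w z]
  by (simp add: sdist_eq arccos_le_mono)

lemma norm_diff_sphere:
  assumes "u \<in> sphere 0 1" "v \<in> sphere 0 1"
  shows "(norm (u - v))\<^sup>2 = 2 - 2 * (u \<bullet> v)"
  using sphere_inner_self[OF assms(1)] sphere_inner_self[OF assms(2)]
  by (simp add: power2_norm_eq_inner inner_diff inner_commute)

lemma norm_diff_le_iff_sphere:
  assumes "u \<in> sphere 0 1" "v \<in> sphere 0 1" "w \<in> sphere 0 1" "z \<in> sphere 0 1"
  shows "norm (u - v) \<le> norm (w - z) \<longleftrightarrow> w \<bullet> z \<le> u \<bullet> v"
proof -
  have "norm (u - v) \<le> norm (w - z) \<longleftrightarrow> (norm (u - v))\<^sup>2 \<le> (norm (w - z))\<^sup>2"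
    by (simp add: power2_le_iff_abs_le)
  then show ?thesis
    unfolding norm_diff_sphere[OF assms(1,2)] norm_diff_sphere[OF assms(3,4)] by linarith
qed

lemma inner_diff_le_norm_sphere:
  assumes "z \<in> sphere 0 1"
  shows "z \<bullet> u - z \<bullet> v \<le> norm (u - v)"
  using norm_cauchy_schwarz[of z "u - v"] assms by (simp add: inner_diff_right)

section \<open>Points of an arc as combinations of its ends\<close>

text \<open>
  Concavity of the sine on $[0,\pi]$, between $0$ and $l$.
\<close>
lemma sin_mult_ge:
  assumes "0 \<le> b" "b \<le> 1" "0 \<le> l" "l \<le> pi"
  shows "b * sin l \<le> sin (b * l)"
proof -
  have "convex_on {0..pi} (\<lambda>x. - sin x)"
  proof (rule f''_ge0_imp_convex)
    show "((\<lambda>x. - sin x) has_real_derivative - cos x) (at x)" for x :: real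
      by (auto intro!: derivative_eq_intros)
    show "((\<lambda>x. - cos x) has_real_derivative sin x) (at x)" for x :: real
      by (auto intro!: derivative_eq_intros)
  qed (auto intro: sin_ge_zero)
  from convex_onD[OF this, of b 0 l] show ?thesis using assms by simp
qed

lemma arc_point_nonneg_combination:
  assumes "u \<in> sphere 0 1" "v \<in> sphere 0 1" "sdist u v < pi" "t \<in> {0..sdist u v}"
  obtains p q where "0 \<le> p" "0 \<le> q" "arc_point u v t = p *\<^sub>R u + q *\<^sub>R v"
proof (cases "u = v")
  case True
  then show ?thesis by (intro that[of 1 0]) (auto simp: arc_point_def)
next
  case False
  then show ?thesis
    using assms sin_sdist_pos[of u v]
    by (intro that[of "sin (sdist u v - t) / sin (sdist u v)" "sin t / sin (sdist u v)"])
       (auto simp: arc_point_def intro!: divide_nonneg_pos sin_ge_zero)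
qed

text \<open>
  On an arc of length $l$ the coefficients are $\sin(bl)/\sin l$ and $\sin((1-b)l)/\sin l$, which
  dominate the coefficients $b$ and $1-b$ of a convex combination in a vector space: the sphere
  bulges out from the chord.
\<close>
lemma gcomb_combination:
  assumes uv: "u \<in> sphere 0 1" "v \<in> sphere 0 1" "sdist u v < pi" and b: "b \<in> {0..1}"
  obtains s t where "b \<le> s" "1 - b \<le> t" "gcomb b u v = s *\<^sub>R u + t *\<^sub>R v"
proof (cases "u = v")
  case True
  then have "gcomb b u v = b *\<^sub>R u + (1 - b) *\<^sub>R v"
    using gcomb_eq[OF assms] by (simp add: arc_point_def flip: scaleR_left_distrib)
  then show ?thesis by (intro that[of b "1 - b"]) auto
next
  case False
  define l where "l = sdist u v"
  have l: "sin l > 0" "0 \<le> l" "l \<le> pi"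
    using sin_sdist_pos[OF uv(1,2) False uv(3)] sdist_nonneg[of u v] uv(3) by (auto simp: l_def)
  have "l - (1 - b) * l = b * l" by (simp add: algebra_simps)
  then have "gcomb b u v = (sin (b * l) / sin l) *\<^sub>R u + (sin ((1 - b) * l) / sin l) *\<^sub>R v"
    using gcomb_eq[OF assms] False by (simp add: arc_point_def l_def)
  moreover have "b \<le> sin (b * l) / sin l" "1 - b \<le> sin ((1 - b) * l) / sin l"
    using sin_mult_ge[of b l] sin_mult_ge[of "1 - b" l] l b by (auto simp: pos_le_divide_eq)
  ultimately show ?thesis by (intro that)
qed

lemma gcomb_in_segment:
  assumes "u \<in> sphere 0 1" "v \<in> sphere 0 1" "sdist u v < pi" "b \<in> {0..1}"
  shows "gcomb b u v \<in> geodesic_segment u v"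
  using gcomb_eq[OF assms] geodesic_segment_eq[OF assms(1-3)] assms(4) sdist_nonneg[of u v]
  by (auto simp: mult_left_le_one_le)

section \<open>Closed convex sets with all distances below a quarter circle\<close>

locale acute_convex =
  fixes C :: "'a::{real_inner, complete_space} set"
  assumes sub: "C \<subseteq> sphere 0 1"
    and closedin: "closedin sph.mtopology C"
    and acute: "\<And>v v'. v \<in> C \<Longrightarrow> v' \<in> C \<Longrightarrow> sdist v v' < pi / 2"
    and gconvex: "geodesically_convex C"
begin

lemma in_sphere: "v \<in> C \<Longrightarrow> v \<in> sphere 0 1"
  using sub by blast

lemma less_pi: "u \<in> C \<Longrightarrow> v \<in> C \<Longrightarrow> sdist u v < pi"
  using acute[of u v] pi_gt_zero by linarith

lemma inner_pos:
  assumes "u \<in> C" "v \<in> C"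
  shows "0 < u \<bullet> v"
proof -
  have "0 < cos (sdist u v)"
    using acute[OF assms] sdist_nonneg[of u v] by (intro cos_gt_zero_pi) linarith+
  then show ?thesis using assms in_sphere by (simp only: cos_sdist)
qed

lemma inner_le_1: "u \<in> C \<Longrightarrow> v \<in> C \<Longrightarrow> u \<bullet> v \<le> 1"
  using in_sphere inner_sphere_bounds(3) by blast

lemma gcomb_in: "u \<in> C \<Longrightarrow> v \<in> C \<Longrightarrow> b \<in> {0..1} \<Longrightarrow> gcomb b u v \<in> C"
  using gcomb_in_segment[of u v b] gconvex in_sphere less_pi
  unfolding geodesically_convex_def by blast

lemma gconvex_halfspaces:
  "geodesically_convex {z \<in> C. \<forall>w\<in>V. 0 \<le> w \<bullet> z}"
  unfolding geodesically_convex_def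
proof (intro ballI subsetI)
  fix u v z
  assume u: "u \<in> {z \<in> C. \<forall>w\<in>V. 0 \<le> w \<bullet> z}" and v: "v \<in> {z \<in> C. \<forall>w\<in>V. 0 \<le> w \<bullet> z}"
    and z: "z \<in> geodesic_segment u v"
  have uv: "u \<in> sphere 0 1" "v \<in> sphere 0 1" "sdist u v < pi"
    using u v in_sphere less_pi by blast+
  have "z \<in> C" using u v z gconvex unfolding geodesically_convex_def by blast
  moreover obtain t where "t \<in> {0..sdist u v}" and zt: "z = arc_point u v t"
    using z geodesic_segment_eq[OF uv] by blast
  then obtain p q where "0 \<le> p" "0 \<le> q" "z = p *\<^sub>R u + q *\<^sub>R v"
    using arc_point_nonneg_combination[OF uv] by metis
  ultimately show "z \<in> {z \<in> C. \<forall>w\<in>V. 0 \<le> w \<bullet> z}"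
    using u v by (auto simp: inner_add_right)
qed

lemma closedin_halfspaces:
  "closedin sph.mtopology {z \<in> C. \<forall>w\<in>V. 0 \<le> w \<bullet> z}"
proof -
  have "{z \<in> C. \<forall>w\<in>V. 0 \<le> w \<bullet> z} = C \<inter> (\<Inter>w\<in>V. {z. 0 \<le> w \<bullet> z})" by auto
  moreover have "closed {z. 0 \<le> w \<bullet> z}" for w :: 'a
    using closed_halfspace_ge[of 0 w] by simp
  ultimately show ?thesis
    using closedin sub by (auto simp: closedin_sph_iff intro!: closed_Int closed_INT)
qed

text \<open>
  The projection $p$ maximises $\langle x,\cdot\rangle$ on $K$, hence on the arc from $p$ to $z$; so the
  derivative of $\langle x,\cdot\rangle$ along this arc is not positive at $p$. The resulting inequality
  $\cos d(x,z) \le \cos d(x,p)\,\cos d(p,z)$ is a spherical form of the variational inequality for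
  projections: it says that the angle at $p$ is not acute.
\<close>
lemma metric_proj_variational:
  assumes K: "K \<subseteq> C" "closedin sph.mtopology K" "geodesically_convex K" "K \<noteq> {}"
    and x: "x \<in> C"
  shows "metric_proj K x \<in> K"
    and "\<And>z. z \<in> K \<Longrightarrow> x \<bullet> z \<le> (x \<bullet> metric_proj K x) * (metric_proj K x \<bullet> z)"
proof -
  define p where "p = metric_proj K x"
  have "\<exists>!p. p \<in> K \<and> sdist x p = (INF y\<in>K. sdist x y)"
    using K x acute in_sphere by (intro metric_proj_unique_existence) blast+
  from theI'[OF this] have p: "p \<in> K" "sdist x p = (INF y\<in>K. sdist x y)"
    by (simp_all add: p_def metric_proj_def)
  then show "metric_proj K x \<in> K" by (simp add: p_def)
  have pC: "p \<in> C" using p K by blast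
  have max: "x \<bullet> z \<le> x \<bullet> p" if "z \<in> K" for z
  proof -
    have "sdist x p \<le> sdist x z"
      unfolding p(2) using that sdist_nonneg by (intro cINF_lower bdd_belowI[of _ 0]) auto
    then show ?thesis using that K x pC in_sphere by (subst sdist_le_iff[symmetric]) auto
  qed
  show "x \<bullet> z \<le> (x \<bullet> metric_proj K x) * (metric_proj K x \<bullet> z)" if z: "z \<in> K" for z
  proof (cases "z = p")
    case True
    then show ?thesis using pC in_sphere sphere_inner_self[of p] by (simp add: p_def)
  next
    case False
    have zC: "z \<in> C" using z K by blast
    define l where "l = sdist p z"
    have pz: "p \<in> sphere 0 1" "z \<in> sphere 0 1" "sdist p z < pi"
      using pC zC in_sphere less_pi by auto
    have l: "0 < l" "0 < sin l" "cos l = p \<bullet> z"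
      using pz False sin_sdist_pos[of p z] sph.mdist_pos_less[of p z] cos_sdist[of p z]
      by (auto simp: l_def)
    define g where "g t = (sin (l - t) * (x \<bullet> p) + sin t * (x \<bullet> z)) / sin l" for t
    have g: "g t = x \<bullet> arc_point p z t" for t
      using False by (simp add: g_def arc_point_def l_def inner_add_right add_divide_distrib)
    have "(g has_real_derivative (x \<bullet> z - (x \<bullet> p) * (p \<bullet> z)) / sin l) (at 0)"
      unfolding g_def using l by (auto intro!: derivative_eq_intros)
    moreover have "g t \<le> g 0" if "0 < t" "t < l" for t
    proof -
      have "arc_point p z t \<in> geodesic_segment p z"
        using that geodesic_segment_eq[OF pz] by (auto simp: l_def)
      then have "arc_point p z t \<in> K"
        using K(3) p(1) z unfolding geodesically_convex_def by blast
      then show ?thesis using max l by (simp add: g arc_point_ends[OF pz])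
    qed
    ultimately have "\<not> 0 < (x \<bullet> z - (x \<bullet> p) * (p \<bullet> z)) / sin l"
      by (metis (no_types, lifting) DERIV_pos_inc_right add_0 dense l(1) min_less_iff_conj not_less)
    then show ?thesis using l by (simp add: p_def zero_less_divide_iff)
  qed
qed

lemma nonexpansive_inner:
  assumes "nonexpansive_on C T" "T \<in> C \<rightarrow> C" "u \<in> C" "v \<in> C"
  shows "u \<bullet> v \<le> T u \<bullet> T v"
  using assms sdist_le_iff[of "T u" "T v" u v] in_sphere
  unfolding nonexpansive_on_def by (metis funcset_mem)

lemma Fix_inner_le:
  assumes "nonexpansive_on C T" "T \<in> C \<rightarrow> C" "z \<in> Fix C T" "u \<in> C"
  shows "z \<bullet> u \<le> z \<bullet> T u"
  using nonexpansive_inner[OF assms(1,2), of z u] assms(3,4) by (auto simp: Fix_def)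

lemma eq_if_inner_ge_1:
  assumes "u \<in> C" "v \<in> C" "1 \<le> u \<bullet> v"
  shows "u = v"
  using assms inner_le_1[of u v] sphere_inner_eq_1[of u v] in_sphere by force

text \<open>
  For fixed $z$, nonexpansiveness gives $\langle z,Tu\rangle = \langle Tz,Tu\rangle \ge \langle z,u\rangle$
  for all $u$. Conversely, $u = z$ alone forces $\langle Tz,z\rangle \ge 1$, that is $Tz = z$.
  Closedness and convexity of the fixed point set follow at once from this description.
\<close>
lemma Fix_eq_halfspaces:
  assumes T: "nonexpansive_on C T" "T \<in> C \<rightarrow> C"
  shows "Fix C T = {z \<in> C. \<forall>w\<in>(\<lambda>u. T u - u) ` C. 0 \<le> w \<bullet> z}"
proof (intro equalityI subsetI)
  fix z assume "z \<in> Fix C T"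
  then show "z \<in> {z \<in> C. \<forall>w\<in>(\<lambda>u. T u - u) ` C. 0 \<le> w \<bullet> z}"
    using Fix_inner_le[OF T, of z] by (auto simp: inner_diff_left inner_commute[of _ z] Fix_def)
next
  fix z assume "z \<in> {z \<in> C. \<forall>w\<in>(\<lambda>u. T u - u) ` C. 0 \<le> w \<bullet> z}"
  then have z: "z \<in> C" "0 \<le> (T z - z) \<bullet> z" by auto
  then have "1 \<le> T z \<bullet> z"
    using sphere_inner_self[OF in_sphere] by (simp add: inner_diff_left)
  then show "z \<in> Fix C T"
    using eq_if_inner_ge_1[of "T z" z] z T by (auto simp: Fix_def)
qed

section \<open>Asymptotic regularity of W-mappings\<close>

text \<open>
  Write the combination as $su + tv$ with $s \ge b$, $t \ge 1-b$. It is a unit vector, so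
  $(s+t)^2 - 1 = 2st(1 - \langle u,v\rangle)$: the excess of $s+t$ over $1$ measures how far apart $u$
  and $v$ are. This uniform convexity of the sphere is the source of asymptotic regularity.
\<close>
lemma gcomb_inner_gain:
  assumes "u \<in> C" "v \<in> C" "z \<in> C" and b: "0 < a" "b \<in> {a..1 - a}"
    and vu: "z \<bullet> v \<le> z \<bullet> u"
  shows "z \<bullet> v + a * (z \<bullet> u - z \<bullet> v) + 2 / 3 * a\<^sup>2 * (1 - u \<bullet> v) * (z \<bullet> v) \<le> z \<bullet> gcomb b u v"
proof -
  note S = in_sphere[OF assms(1)] in_sphere[OF assms(2)] in_sphere[OF assms(3)]
  have b01: "b \<in> {0..1}" using b by auto
  obtain s t where st: "b \<le> s" "1 - b \<le> t" and g: "gcomb b u v = s *\<^sub>R u + t *\<^sub>R v"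
    using gcomb_combination[OF S(1,2) less_pi[OF assms(1,2)] b01] .
  have st': "a \<le> s" "a \<le> t" using st b by auto
  have uv: "0 < u \<bullet> v" "u \<bullet> v \<le> 1" "0 < z \<bullet> v"
    using inner_pos inner_le_1 assms by auto
  have "gcomb b u v \<bullet> gcomb b u v = 1"
    using gcomb_in[OF assms(1,2) b01] in_sphere sphere_inner_self by blast
  then have unit: "s\<^sup>2 + t\<^sup>2 + 2 * s * t * (u \<bullet> v) = 1"
    unfolding g using S(1,2)[THEN sphere_inner_self]
    by (simp add: inner_add inner_commute power2_eq_square algebra_simps)
  have st0: "0 \<le> s" "0 \<le> t" using st' b by auto
  have "0 \<le> 2 * s * t * (u \<bullet> v)" using st0 uv by simp
  then have "s\<^sup>2 + t\<^sup>2 \<le> 1" using unit by linarith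
  then have "s\<^sup>2 \<le> 1" "t\<^sup>2 \<le> 1"
    using zero_le_power2[of s] zero_le_power2[of t] by linarith+
  then have "s \<le> 1" "t \<le> 1" using st0 by (simp_all add: power_le_one_iff)
  \<comment> \<open>\<open>s + t + 1\<close> is at most 3, which is where the constant comes from\<close>
  have st1: "1 \<le> s + t" using st by linarith
  have "2 * a\<^sup>2 * (1 - u \<bullet> v) \<le> 2 * (s * t) * (1 - u \<bullet> v)"
    using st' b uv by (intro mult_right_mono) (auto simp: power2_eq_square intro!: mult_mono)
  also have "\<dots> = (s + t - 1) * (s + t + 1)" using unit by (simp add: power2_eq_square algebra_simps)
  also have "\<dots> \<le> (s + t - 1) * 3"
    using \<open>s \<le> 1\<close> \<open>t \<le> 1\<close> st1 by (intro mult_left_mono) auto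
  finally have gap: "2 / 3 * a\<^sup>2 * (1 - u \<bullet> v) \<le> s + t - 1" by simp
  have "2 / 3 * a\<^sup>2 * (1 - u \<bullet> v) * (z \<bullet> v) \<le> (s + t - 1) * (z \<bullet> v)"
    using gap uv by (intro mult_right_mono) auto
  moreover have "a * (z \<bullet> u - z \<bullet> v) \<le> s * (z \<bullet> u - z \<bullet> v)"
    using st' vu by (intro mult_right_mono) auto
  ultimately show ?thesis unfolding g by (simp add: inner_add_right algebra_simps)
qed

text \<open>
  With $s + t \ge 1$ and $\langle u,v\rangle \le 1$,
  $\langle su+tv,v\rangle = s\langle u,v\rangle + t \ge (s+t)\langle u,v\rangle \ge \langle u,v\rangle$.
\<close>
lemma norm_gcomb_diff_le:
  assumes "u \<in> C" "v \<in> C" "b \<in> {0..1}"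
  shows "norm (gcomb b u v - v) \<le> norm (u - v)"
proof -
  note S = in_sphere[OF assms(1)] in_sphere[OF assms(2)]
  obtain s t where st: "b \<le> s" "1 - b \<le> t" and g: "gcomb b u v = s *\<^sub>R u + t *\<^sub>R v"
    using gcomb_combination[OF S less_pi[OF assms(1,2)] assms(3)] .
  have uv: "0 < u \<bullet> v" "u \<bullet> v \<le> 1" using inner_pos inner_le_1 assms by auto
  have "u \<bullet> v \<le> (s + t) * (u \<bullet> v)" using st uv by simp
  also have "\<dots> \<le> s * (u \<bullet> v) + t" using st assms uv by (simp add: distrib_right mult_left_le)
  also have "\<dots> = gcomb b u v \<bullet> v"
    unfolding g using sphere_inner_self[OF S(2)] by (simp add: inner_add_left)
  finally show ?thesis
    using norm_diff_le_iff_sphere[OF in_sphere[OF gcomb_in[OF assms]] S(2) S] by simp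
qed

context
  fixes T :: "nat \<Rightarrow> 'a \<Rightarrow> 'a" and r :: nat and a :: real
  assumes self: "\<And>i. i \<in> {1..r} \<Longrightarrow> T i \<in> C \<rightarrow> C"
    and nonexp: "\<And>i. i \<in> {1..r} \<Longrightarrow> nonexpansive_on C (T i)"
    and a_pos: "0 < a"
begin

lemma W_map_in:
  assumes "\<beta> \<in> {1..r} \<rightarrow> {a..1 - a}" "x \<in> C" "k \<le> r"
  shows "W_map T \<beta> k x \<in> C"
  using assms(3)
proof (induction k)
  case (Suc k)
  moreover have "\<beta> (Suc k) \<in> {0..1}" using funcset_mem[OF assms(1), of "Suc k"] Suc.prems a_pos by auto
  moreover have "T (Suc k) \<in> C \<rightarrow> C" using self[of "Suc k"] Suc.prems by auto
  ultimately show ?case using assms(2) by (auto intro!: gcomb_in)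
qed (use assms in auto)

text \<open>
  At a common fixed point $z$ the mapping $T_{k+1}$ can only increase the inner product of $z$ with $U_k x$, so
  the gain of the convex combination forming $U_{k+1}x$ can be expressed by that of $U_k x$.
\<close>
lemma W_map_inner_gain:
  assumes \<beta>: "\<beta> \<in> {1..r} \<rightarrow> {a..1 - a}" and x: "x \<in> C"
    and z: "z \<in> (\<Inter>i\<in>{1..r}. Fix C (T i))" "z \<in> C"
    and k: "Suc k \<le> r" and IH: "z \<bullet> x \<le> z \<bullet> W_map T \<beta> k x"
  shows "z \<bullet> x + a * (z \<bullet> W_map T \<beta> k x - z \<bullet> x)
      + 2 / 3 * a\<^sup>2 * (1 - T (Suc k) (W_map T \<beta> k x) \<bullet> x) * (z \<bullet> x) \<le> z \<bullet> W_map T \<beta> (Suc k) x"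
proof -
  define u where "u = W_map T \<beta> k x"
  have i: "Suc k \<in> {1..r}" using k by auto
  have u: "u \<in> C" using W_map_in[OF \<beta> x, of k] k by (simp add: u_def)
  have Tu: "T (Suc k) u \<in> C" using self[OF i] u by blast
  have zT: "z \<bullet> u \<le> z \<bullet> T (Suc k) u"
    using Fix_inner_le[OF nonexp[OF i] self[OF i] _ u] z i by blast
  then have "a * (z \<bullet> u - z \<bullet> x) \<le> a * (z \<bullet> T (Suc k) u - z \<bullet> x)"
    using a_pos by (intro mult_left_mono) auto
  moreover have "z \<bullet> x \<le> z \<bullet> T (Suc k) u" using IH zT by (simp add: u_def)
  note gcomb_inner_gain[OF Tu x z(2) a_pos funcset_mem[OF \<beta> i] this]
  ultimately show ?thesis by (simp add: u_def)
qed

lemma W_map_inner_ge: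
  assumes \<beta>: "\<beta> \<in> {1..r} \<rightarrow> {a..1 - a}" and x: "x \<in> C"
    and z: "z \<in> (\<Inter>i\<in>{1..r}. Fix C (T i))" "z \<in> C" and k: "k \<le> r"
  shows "z \<bullet> x \<le> z \<bullet> W_map T \<beta> k x"
  using k
proof (induction k)
  case (Suc k)
  let ?u = "W_map T \<beta> k x"
  have IH: "z \<bullet> x \<le> z \<bullet> ?u" using Suc by simp
  have "T (Suc k) ?u \<in> C"
    using W_map_in[OF \<beta> x, of k] self[of "Suc k"] Suc.prems by auto
  then have "0 \<le> 2 / 3 * a\<^sup>2 * (1 - T (Suc k) ?u \<bullet> x) * (z \<bullet> x)"
    using inner_le_1[OF _ x] inner_pos[OF z(2) x] by simp
  moreover have "0 \<le> a * (z \<bullet> ?u - z \<bullet> x)" using IH a_pos by simp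
  ultimately show ?case using W_map_inner_gain[OF \<beta> x z Suc.prems IH] by linarith
qed simp

text \<open>
  A stage keeps at least the fraction $a$ of the gain over $\langle z,x\rangle$ made so far. So if
  the last stage has gained little, then so has every earlier one.
\<close>
lemma W_map_gain_decay:
  assumes \<beta>: "\<beta> \<in> {1..r} \<rightarrow> {a..1 - a}" and x: "x \<in> C"
    and z: "z \<in> (\<Inter>i\<in>{1..r}. Fix C (T i))" "z \<in> C" and k: "k \<le> r"
  shows "a ^ (r - k) * (z \<bullet> W_map T \<beta> k x - z \<bullet> x) \<le> z \<bullet> W_map T \<beta> r x - z \<bullet> x"
  using k
proof (induction k rule: inc_induct)
  case (step k)
  let ?u = "W_map T \<beta> k x"
  have k: "Suc k \<le> r" using step.hyps by simp
  have IH: "z \<bullet> x \<le> z \<bullet> ?u" using W_map_inner_ge[OF \<beta> x z] k by simp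
  have "T (Suc k) ?u \<in> C"
    using W_map_in[OF \<beta> x, of k] self[of "Suc k"] k by auto
  then have "0 \<le> 2 / 3 * a\<^sup>2 * (1 - T (Suc k) ?u \<bullet> x) * (z \<bullet> x)"
    using inner_le_1[OF _ x] inner_pos[OF z(2) x] by simp
  then have "a * (z \<bullet> ?u - z \<bullet> x) \<le> z \<bullet> W_map T \<beta> (Suc k) x - z \<bullet> x"
    using W_map_inner_gain[OF \<beta> x z k IH] by linarith
  then have "a ^ (r - Suc k) * (a * (z \<bullet> ?u - z \<bullet> x))
      \<le> a ^ (r - Suc k) * (z \<bullet> W_map T \<beta> (Suc k) x - z \<bullet> x)"
    using a_pos by (intro mult_left_mono) auto
  also have "\<dots> \<le> z \<bullet> W_map T \<beta> r x - z \<bullet> x" by (rule step.IH)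
  finally show ?case
    using step.hyps by (simp add: mult_ac flip: Suc_diff_Suc)
qed simp

text \<open>
  Two points of the sphere satisfy $\|u-v\|^2 = 2(1-\langle u,v\rangle)$, so the last summand in
  \<open>W_map_inner_gain\<close> is a squared distance; by \<open>W_map_gain_decay\<close> it is controlled by the
  gain of the last stage, which is at most the displacement of $x$ under the whole $W$-mapping.
\<close>
lemma W_map_residual:
  assumes \<beta>: "\<beta> \<in> {1..r} \<rightarrow> {a..1 - a}" and x: "x \<in> C"
    and z: "z \<in> (\<Inter>i\<in>{1..r}. Fix C (T i))" "z \<in> C" and k: "Suc k \<le> r"
  shows "a ^ (r - Suc k) * (a\<^sup>2 / 3 * (z \<bullet> x) * (norm (T (Suc k) (W_map T \<beta> k x) - x))\<^sup>2)
      \<le> norm (W_map T \<beta> r x - x)"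
proof -
  define u where "u = W_map T \<beta> k x"
  have Tu: "T (Suc k) u \<in> C"
    using W_map_in[OF \<beta> x, of k] self[of "Suc k"] k by (auto simp: u_def)
  have IH: "z \<bullet> x \<le> z \<bullet> u" using W_map_inner_ge[OF \<beta> x z, of k] k by (simp add: u_def)
  have "a\<^sup>2 / 3 * (z \<bullet> x) * (norm (T (Suc k) u - x))\<^sup>2 = 2 / 3 * a\<^sup>2 * (1 - T (Suc k) u \<bullet> x) * (z \<bullet> x)"
    using norm_diff_sphere[OF in_sphere[OF Tu] in_sphere[OF x]] by simp
  also have "\<dots> \<le> z \<bullet> W_map T \<beta> (Suc k) x - z \<bullet> x"
    using W_map_inner_gain[OF \<beta> x z k IH[unfolded u_def]] IH
      mult_nonneg_nonneg[of a "z \<bullet> u - z \<bullet> x"] a_pos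
    unfolding u_def[symmetric] by linarith
  finally have "a ^ (r - Suc k) * (a\<^sup>2 / 3 * (z \<bullet> x) * (norm (T (Suc k) u - x))\<^sup>2)
      \<le> a ^ (r - Suc k) * (z \<bullet> W_map T \<beta> (Suc k) x - z \<bullet> x)"
    using a_pos by (intro mult_left_mono) auto
  also have "\<dots> \<le> z \<bullet> W_map T \<beta> r x - z \<bullet> x" by (rule W_map_gain_decay[OF \<beta> x z k])
  also have "\<dots> \<le> norm (W_map T \<beta> r x - x)"
    by (rule inner_diff_le_norm_sphere[OF in_sphere[OF z(2)]])
  finally show ?thesis by (simp add: u_def)
qed

text \<open>
  The residual estimate gives $T_{k+1}U_k x_n - x_n \to 0$ for all $k$. Since $U_k x_n$ lies between
  $T_k U_{k-1}x_n$ and $x_n$, also $U_k x_n - x_n \to 0$, and nonexpansiveness lets one replace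
  $U_k x_n$ by $x_n$ in the first limit. The bound $e$ keeps $z$ away from being orthogonal to $x_n$, where the
  residual estimate degenerates.
\<close>
lemma W_map_asymptotically_regular:
  assumes \<beta>: "\<And>n. \<beta> n \<in> {1..r} \<rightarrow> {a..1 - a}" and x: "\<And>n. x n \<in> C"
    and z: "z \<in> (\<Inter>i\<in>{1..r}. Fix C (T i))" "z \<in> C"
    and e: "0 < e" "\<And>n. e \<le> z \<bullet> x n"
    and lim: "(\<lambda>n. W_map T (\<beta> n) r (x n) - x n) \<longlonglongrightarrow> 0"
    and i: "i \<in> {1..r}"
  shows "(\<lambda>n. T i (x n) - x n) \<longlonglongrightarrow> 0"
proof -
  define U where "U k n = W_map T (\<beta> n) k (x n)" for k n
  have U: "U k n \<in> C" if "k \<le> r" for k n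
    unfolding U_def by (rule W_map_in[OF \<beta> x that])
  have TU: "(\<lambda>n. norm (T (Suc k) (U k n) - x n)) \<longlonglongrightarrow> 0" if k: "Suc k \<le> r" for k
  proof -
    define M where "M = a ^ (r - Suc k) * (a\<^sup>2 / 3 * e)"
    have M: "0 < M" using a_pos e by (simp add: M_def)
    have "(norm (T (Suc k) (U k n) - x n))\<^sup>2 \<le> norm (U r n - x n) / M" for n
    proof -
      have "M * (norm (T (Suc k) (U k n) - x n))\<^sup>2
          \<le> a ^ (r - Suc k) * (a\<^sup>2 / 3 * (z \<bullet> x n) * (norm (T (Suc k) (U k n) - x n))\<^sup>2)"
        unfolding M_def mult.assoc using a_pos e(2)[of n]
        by (intro mult_left_mono mult_right_mono) auto
      also have "\<dots> \<le> norm (U r n - x n)"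
        unfolding U_def by (rule W_map_residual[OF \<beta> x z k])
      finally show ?thesis using M by (simp add: pos_le_divide_eq mult.commute)
    qed
    moreover have "(\<lambda>n. norm (U r n - x n) / M) \<longlonglongrightarrow> 0"
      using tendsto_divide[OF tendsto_norm[OF lim] tendsto_const[of M]] M by (simp add: U_def)
    ultimately have "(\<lambda>n. (norm (T (Suc k) (U k n) - x n))\<^sup>2) \<longlonglongrightarrow> 0"
      by - (rule Lim_null_comparison[OF always_eventually, rotated], auto)
    from tendsto_real_sqrt[OF this] show ?thesis by simp
  qed
  obtain k where k: "i = Suc k" "Suc k \<le> r" using i by (cases i) auto
  have Ux: "(\<lambda>n. norm (U k n - x n)) \<longlonglongrightarrow> 0"
  proof (cases k)
    case 0
    then show ?thesis by (simp add: U_def)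
  next
    case (Suc j)
    have "norm (U k n - x n) \<le> norm (T k (U j n) - x n)" for n
    proof -
      have "T k (U j n) \<in> C" using U[of j n] self[of k] k Suc by auto
      moreover have "\<beta> n k \<in> {0..1}" using funcset_mem[OF \<beta>, of k n] k Suc a_pos by auto
      ultimately show ?thesis using norm_gcomb_diff_le[OF _ x] by (simp add: U_def Suc)
    qed
    then show ?thesis
      using TU[of j] k Suc by - (rule Lim_null_comparison[OF always_eventually, rotated], auto)
  qed
  have "norm (T i (x n) - x n) \<le> norm (U k n - x n) + norm (T i (U k n) - x n)" for n
  proof -
    have Uk: "U k n \<in> C" using U k by simp
    note self[OF i] nonexp[OF i]
    then have "norm (T i (U k n) - T i (x n)) \<le> norm (U k n - x n)"
      using Uk x[of n] nonexpansive_inner[of "T i" "U k n" "x n"] in_sphere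
      by (subst norm_diff_le_iff_sphere) auto
    moreover have "norm (T i (x n) - x n) \<le> norm (T i (x n) - T i (U k n)) + norm (T i (U k n) - x n)"
      using norm_triangle_ineq[of "T i (x n) - T i (U k n)" "T i (U k n) - x n"] by simp
    ultimately show ?thesis by (simp add: norm_minus_commute)
  qed
  moreover have "(\<lambda>n. norm (U k n - x n) + norm (T i (U k n) - x n)) \<longlonglongrightarrow> 0"
    using tendsto_add[OF Ux TU[OF k(2)]] k by simp
  ultimately have "(\<lambda>n. norm (T i (x n) - x n)) \<longlonglongrightarrow> 0"
    by - (rule Lim_null_comparison[OF always_eventually, rotated], auto)
  then show ?thesis by (simp only: tendsto_norm_zero_iff)
qed

end

section \<open>Strong limits in the closed convex hulls of the tails\<close>

text \<open>
  A substitute for a weak cluster point. The sets $D_N$ below are the bipolars of the tails in $C$; they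
  decrease with $N$, and so do the numbers $s_N = \langle x_0,p_N\rangle$ for the projections $p_N$ of
  $x_0$ onto them. The variational inequality gives $s_M \le s_N \langle p_N,p_M\rangle$ for
  $N \le M$, and since $s_N \ge c > 0$, convergence of $s_N$ makes $(p_N)$ a Cauchy sequence in norm.
\<close>
lemma tail_hull_point:
  fixes x :: "nat \<Rightarrow> 'a"
  assumes x: "\<And>n. x n \<in> C" and x0: "x0 \<in> C" and c: "0 < c" "\<And>n. c \<le> x0 \<bullet> x n"
  obtains q where "q \<in> C" "c \<le> x0 \<bullet> q"
    "\<forall>N w. (\<forall>n\<ge>N. 0 \<le> w \<bullet> x n) \<longrightarrow> 0 \<le> w \<bullet> q"
proof -
  define V where "V N = {w. \<forall>n\<ge>N. 0 \<le> w \<bullet> x n}" for N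
  define D where "D N = {z \<in> C. \<forall>w\<in>V N. 0 \<le> w \<bullet> z}" for N
  have V_mono: "V N \<subseteq> V M" if "N \<le> M" for N M
    using order_trans[OF that] by (auto simp: V_def)
  have D_anti: "D M \<subseteq> D N" if "N \<le> M" for N M using V_mono[OF that] by (auto simp: D_def)
  have xD: "x N \<in> D N" for N using x by (auto simp: D_def V_def)
  have D: "D N \<subseteq> C" "closedin sph.mtopology (D N)" "geodesically_convex (D N)" "D N \<noteq> {}" for N
    using closedin_halfspaces gconvex_halfspaces xD[of N] by (auto simp: D_def)
  define p where "p N = metric_proj (D N) x0" for N
  have p: "p N \<in> D N" "\<And>z. z \<in> D N \<Longrightarrow> x0 \<bullet> z \<le> (x0 \<bullet> p N) * (p N \<bullet> z)" for N
    using metric_proj_variational[OF D x0] by (simp_all add: p_def)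
  have pC: "p N \<in> C" for N using p D by blast
  define s where "s N = x0 \<bullet> p N" for N
  have s_le: "s M \<le> s N * (p N \<bullet> p M)" if "N \<le> M" for N M
    using p(2)[of "p M" N] p(1)[of M] D_anti[OF that] by (auto simp: s_def)
  have s_pos: "0 < s N" for N using inner_pos[OF x0 pC] by (simp add: s_def)
  have s_c: "c \<le> s N" for N
  proof -
    have "c \<le> x0 \<bullet> x N" by (rule c)
    also have "\<dots> \<le> s N * (p N \<bullet> x N)" using p(2)[OF xD] by (simp add: s_def)
    also have "\<dots> \<le> s N" using s_pos[of N] inner_le_1[OF pC x] by (simp add: mult_left_le)
    finally show ?thesis .
  qed
  have "decseq s"
  proof (rule decseq_SucI)
    show "s (Suc n) \<le> s n" for n
      using s_le[of n "Suc n"] s_pos[of n] inner_le_1[OF pC pC, of n "Suc n"]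
        mult_left_le[of "p n \<bullet> p (Suc n)" "s n"] by linarith
  qed
  then obtain l where l: "s \<longlonglongrightarrow> l" "\<And>n. l \<le> s n"
    using decseq_convergent[of s c] s_c by blast
  have dist: "c * (norm (p N - p M))\<^sup>2 \<le> 2 * (s N - l)" if "N \<le> M" for N M
  proof -
    have "c * (norm (p N - p M))\<^sup>2 = 2 * (c * (1 - p N \<bullet> p M))"
      unfolding norm_diff_sphere[OF in_sphere[OF pC] in_sphere[OF pC]] by (simp add: algebra_simps)
    also have "\<dots> \<le> 2 * (s N * (1 - p N \<bullet> p M))"
      using s_c[of N] inner_le_1[OF pC pC] by (intro mult_left_mono mult_right_mono) auto
    also have "\<dots> \<le> 2 * (s N - l)" using s_le[OF that] l(2)[of M] by (simp add: algebra_simps)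
    finally show ?thesis .
  qed
  have "Cauchy p"
  proof (rule metric_CauchyI)
    fix e :: real assume e: "0 < e"
    have "0 < c * e\<^sup>2 / 2" using c e by simp
    then obtain N where N: "s N < l + c * e\<^sup>2 / 2"
      using order_tendstoD(2)[OF l(1), of "l + c * e\<^sup>2 / 2"] eventually_sequentially by auto
    have close: "dist (p m) (p n) < e" if mn: "N \<le> m" "m \<le> n" for m n
    proof -
      have "s m \<le> s N" using \<open>decseq s\<close> mn by (simp add: decseqD)
      then have "2 * (s m - l) < c * e\<^sup>2" using N by (simp add: field_simps)
      then have "c * (norm (p m - p n))\<^sup>2 < c * e\<^sup>2" using dist[OF mn(2)] by linarith
      then show ?thesis using c e by (simp add: dist_norm power2_less_imp_less)
    qed
    then have "dist (p m) (p n) < e" if "N \<le> m" "N \<le> n" for m n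
      using that close[of m n] close[of n m] by (metis dist_commute nle_le)
    then show "\<exists>M. \<forall>m\<ge>M. \<forall>n\<ge>M. dist (p m) (p n) < e" by blast
  qed
  then obtain q where q: "p \<longlonglongrightarrow> q" using Cauchy_convergent_iff convergentD by blast
  have qD: "q \<in> D N" for N
  proof -
    have "closed (D N)" using D(2) closedin_sph_iff by blast
    moreover have "p (n + N) \<in> D N" for n using p(1)[of "n + N"] D_anti[of N "n + N"] by auto
    moreover have "(\<lambda>n. p (n + N)) \<longlonglongrightarrow> q" using q by (rule LIMSEQ_ignore_initial_segment)
    ultimately show ?thesis by (rule closed_sequentially)
  qed
  have "(\<lambda>n. x0 \<bullet> p n) \<longlonglongrightarrow> x0 \<bullet> q" by (intro tendsto_intros q)
  then have "c \<le> x0 \<bullet> q" using s_c by (intro LIMSEQ_le_const) (auto simp: s_def)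
  moreover have "0 \<le> w \<bullet> q" if "\<forall>n\<ge>N. 0 \<le> w \<bullet> x n" for N w
    using qD[of N] that by (simp add: D_def V_def)
  moreover have "q \<in> C" using qD D(1) by blast
  ultimately show ?thesis using that by blast
qed

text \<open>
  Nonexpansiveness gives
  $\langle Tq - q,x_n\rangle \ge \langle Tq,Tx_n\rangle - \langle q,x_n\rangle - \|Tx_n - x_n\| \ge -\|Tx_n - x_n\|$.
  So $\langle Tq - q,\cdot\rangle$ is almost nonnegative on the tails. The error must be absorbed into
  a homogeneous functional before the hypothesis on $q$ applies: as $\langle x_0,x_n\rangle \ge c$, adding
  $\varepsilon x_0$ to $Tq - q$ makes the functional nonnegative on a tail.
\<close>
lemma demiclosed:
  fixes x :: "nat \<Rightarrow> 'a"
  assumes T: "nonexpansive_on C T" "T \<in> C \<rightarrow> C" and x: "\<And>n. x n \<in> C"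
    and x0: "x0 \<in> C" and c: "0 < c" "\<And>n. c \<le> x0 \<bullet> x n"
    and q: "q \<in> C" and hull: "\<forall>N w. (\<forall>n\<ge>N. 0 \<le> w \<bullet> x n) \<longrightarrow> 0 \<le> w \<bullet> q"
    and reg: "(\<lambda>n. T (x n) - x n) \<longlonglongrightarrow> 0"
  shows "T q = q"
proof -
  have Tq: "T q \<in> C" using T q by blast
  have "1 \<le> T q \<bullet> q + e" if e: "0 < e" for e
  proof -
    have "eventually (\<lambda>n. norm (T (x n) - x n) < e * c) sequentially"
      using order_tendstoD(2)[OF tendsto_norm_zero[OF reg]] e c by simp
    then obtain N where N: "\<And>n. N \<le> n \<Longrightarrow> norm (T (x n) - x n) < e * c"
      by (auto simp: eventually_sequentially)
    have "0 \<le> (T q - q + e *\<^sub>R x0) \<bullet> x n" if "N \<le> n" for n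
    proof -
      have "q \<bullet> x n \<le> T q \<bullet> T (x n)" by (rule nonexpansive_inner[OF T q x])
      moreover have "T q \<bullet> T (x n) - T q \<bullet> x n \<le> norm (T (x n) - x n)"
        by (rule inner_diff_le_norm_sphere[OF in_sphere[OF Tq]])
      moreover have "e * c \<le> e * (x0 \<bullet> x n)" using e c by simp
      ultimately show ?thesis using N[OF that] by (simp add: inner_add_left inner_diff_left)
    qed
    then have "0 \<le> (T q - q + e *\<^sub>R x0) \<bullet> q" using hull by blast
    moreover have "e * (x0 \<bullet> q) \<le> e" using e inner_le_1[OF x0 q] by (simp add: mult_left_le)
    ultimately show ?thesis
      using sphere_inner_self[OF in_sphere[OF q]] by (simp add: inner_add_left inner_diff_left)
  qed
  then have "1 \<le> T q \<bullet> q" by (rule field_le_epsilon)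
  then show ?thesis using eq_if_inner_ge_1 Tq q by blast
qed

end

section \<open>Convergence of the iteration\<close>

theorem theorem1p1:
  fixes C :: "'a::{real_inner, complete_space} set"
    and r :: nat and a :: real
    and \<alpha> :: "nat \<Rightarrow> nat \<Rightarrow> real"
    and T :: "nat \<Rightarrow> 'a \<Rightarrow> 'a"
    and F :: "'a set"
    and x y :: "nat \<Rightarrow> 'a"
    and Cs Qs :: "nat \<Rightarrow> 'a set"
  assumes "C \<subseteq> sphere 0 1"
    and "closedin sph.mtopology C"
    and "\<And>v v'. v \<in> C \<Longrightarrow> v' \<in> C \<Longrightarrow> sdist v v' < pi / 2"
    and "geodesically_convex C"
    and "1 \<le> r"
    and "0 < a" and "a < 1 / 2"
    and "\<And>n i. 1 \<le> n \<Longrightarrow> i \<in> {1..r} \<Longrightarrow> \<alpha> n i \<in> {a..1 - a}"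
    and "\<And>i. i \<in> {1..r} \<Longrightarrow> T i \<in> C \<rightarrow> C"
    and "\<And>i. i \<in> {1..r} \<Longrightarrow> nonexpansive_on C (T i)"
    and "F = (\<Inter>i\<in>{1..r}. Fix C (T i))"
    and "F \<noteq> {}"
    and "x 1 \<in> C"
    and "\<And>n. 1 \<le> n \<Longrightarrow> y n = W_map T (\<alpha> n) r (x n)"
    and "\<And>n. 1 \<le> n \<Longrightarrow> Cs n = {z \<in> C. sdist (y n) z \<le> sdist (x n) z}"
    and "\<And>n. 1 \<le> n \<Longrightarrow>
           Qs n = {z \<in> C. cos (sdist (x 1) (x n)) * cos (sdist (x n) z) \<ge> cos (sdist (x 1) z)}"
    and "\<And>n. 1 \<le> n \<Longrightarrow> x (Suc n) = metric_proj (Cs n \<inter> Qs n) (x 1)"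
  shows "(\<forall>n\<ge>1. x n \<in> C \<and> Cs n \<inter> Qs n \<noteq> {} \<and> Cs n \<inter> Qs n \<subseteq> C \<and>
                closedin sph.mtopology (Cs n \<inter> Qs n) \<and> geodesically_convex (Cs n \<inter> Qs n)) \<and>
         limitin sph.mtopology x (metric_proj F (x 1)) sequentially"
proof -
  note C_hyps = assms(1-4) and F_eq = assms(11)
  interpret acute_convex C by unfold_locales (use C_hyps in auto)
  note self = assms(9) and nonexp = assms(10)
  note y_eq = assms(14) and Cs_eq = assms(15) and Qs_eq = assms(16) and x_Suc = assms(17)
  have \<beta>: "\<alpha> n \<in> {1..r} \<rightarrow> {a..1 - a}" if "1 \<le> n" for n
    using assms(8)[OF that] by blast

  have "F = {z \<in> C. \<forall>w\<in>(\<Union>i\<in>{1..r}. (\<lambda>u. T i u - u) ` C). 0 \<le> w \<bullet> z}"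
    using assms(5) Fix_eq_halfspaces[OF nonexp self] unfolding F_eq by fastforce
  then obtain V where FV: "F = {z \<in> C. \<forall>w\<in>V. 0 \<le> w \<bullet> z}" by blast
  have F: "F \<subseteq> C" "closedin sph.mtopology F" "geodesically_convex F"
    unfolding FV by (blast, rule closedin_halfspaces, rule gconvex_halfspaces)

  define K where "K n = Cs n \<inter> Qs n" for n
  have yC: "y n \<in> C" if "1 \<le> n" "x n \<in> C" for n
    using y_eq[OF that(1)] W_map_in[OF self nonexp assms(6) \<beta>[OF that(1)] that(2)] by simp
  have Cs: "z \<in> Cs n \<longleftrightarrow> z \<in> C \<and> x n \<bullet> z \<le> y n \<bullet> z" if "1 \<le> n" "x n \<in> C" for n z
    using yC[OF that] that in_sphere Cs_eq[OF that(1)] by (auto simp: sdist_le_iff)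
  have Qs: "z \<in> Qs n \<longleftrightarrow> z \<in> C \<and> x 1 \<bullet> z \<le> (x 1 \<bullet> x n) * (x n \<bullet> z)"
    if "1 \<le> n" "x n \<in> C" for n z
    using that in_sphere assms(13) Qs_eq[OF that(1)] by (auto simp: cos_sdist)
  have K: "K n \<subseteq> C" "closedin sph.mtopology (K n)" "geodesically_convex (K n)"
    if "1 \<le> n" "x n \<in> C" for n
  proof -
    have "K n = {z \<in> C. \<forall>w\<in>{y n - x n, (x 1 \<bullet> x n) *\<^sub>R x n - x 1}. 0 \<le> w \<bullet> z}"
      using Cs[OF that] Qs[OF that] by (auto simp: K_def inner_diff_left)
    then obtain V where KV: "K n = {z \<in> C. \<forall>w\<in>V. 0 \<le> w \<bullet> z}" by blast
    show "K n \<subseteq> C" "closedin sph.mtopology (K n)" "geodesically_convex (K n)"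
      unfolding KV by (blast, rule closedin_halfspaces, rule gconvex_halfspaces)
  qed
  have F_Cs: "F \<subseteq> Cs n" if "1 \<le> n" "x n \<in> C" for n
  proof
    fix z assume z: "z \<in> F"
    have "z \<bullet> x n \<le> z \<bullet> W_map T (\<alpha> n) r (x n)"
    proof (rule W_map_inner_ge[OF self nonexp assms(6) \<beta>[OF that(1)] that(2)])
      show "z \<in> (\<Inter>i\<in>{1..r}. Fix C (T i))" using z by (simp only: F_eq)
      show "z \<in> C" using z F(1) by blast
    qed simp_all
    then show "z \<in> Cs n"
      using Cs[OF that] z F(1) y_eq[OF that(1)] by (auto simp: inner_commute)
  qed
  have proj: "x (Suc n) \<in> K n" "\<And>z. z \<in> K n \<Longrightarrow> x 1 \<bullet> z \<le> (x 1 \<bullet> x (Suc n)) * (x (Suc n) \<bullet> z)"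
    if "1 \<le> n" "x n \<in> C" "F \<subseteq> Qs n" for n
  proof -
    have "K n \<noteq> {}" using F_Cs[OF that(1,2)] that(3) assms(12) by (auto simp: K_def)
    from metric_proj_variational[OF K[OF that(1,2)] this assms(13)]
    show "x (Suc n) \<in> K n" "\<And>z. z \<in> K n \<Longrightarrow> x 1 \<bullet> z \<le> (x 1 \<bullet> x (Suc n)) * (x (Suc n) \<bullet> z)"
      using x_Suc[OF that(1)] by (simp_all add: K_def)
  qed
  \<comment> \<open>\<open>Qs 1 = C\<close> starts the induction; the variational inequality for \<open>K n\<close> carries it on\<close>
  have inv: "x n \<in> C \<and> F \<subseteq> Qs n" if "1 \<le> n" for n
    using that
  proof (induction n rule: nat_induct_at_least)
    case base
    then show ?case
      using Qs[of 1] assms(13) F(1) in_sphere sphere_inner_self[of "x 1"] by auto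
  next
    case (Suc n)
    then have FK: "F \<subseteq> K n" using F_Cs by (simp add: K_def)
    have "x (Suc n) \<in> C" using proj(1) K(1) Suc by blast
    moreover have "z \<in> Qs (Suc n)" if "z \<in> F" for z
      using Qs[of "Suc n" z] calculation proj(2)[of n z] Suc FK F(1) that by auto
    ultimately show ?case by blast
  qed
  have well_defined: "\<forall>n\<ge>1. x n \<in> C \<and> Cs n \<inter> Qs n \<noteq> {} \<and> Cs n \<inter> Qs n \<subseteq> C \<and>
      closedin sph.mtopology (Cs n \<inter> Qs n) \<and> geodesically_convex (Cs n \<inter> Qs n)"
  proof (intro allI impI)
    fix n :: nat assume n: "1 \<le> n"
    have xn: "x n \<in> C" "F \<subseteq> Qs n" using inv[OF n] by auto
    show "x n \<in> C \<and> Cs n \<inter> Qs n \<noteq> {} \<and> Cs n \<inter> Qs n \<subseteq> C \<and>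
        closedin sph.mtopology (Cs n \<inter> Qs n) \<and> geodesically_convex (Cs n \<inter> Qs n)"
      using xn proj(1)[OF n xn] K[OF n xn(1)] unfolding K_def by auto
  qed

  define p where "p = metric_proj F (x 1)"
  have pF: "p \<in> F" and p_max: "\<And>z. z \<in> F \<Longrightarrow> x 1 \<bullet> z \<le> (x 1 \<bullet> p) * (p \<bullet> z)"
    using metric_proj_variational[OF F assms(12,13)] by (auto simp: p_def)
  have pC: "p \<in> C" using pF F by blast
  \<comment> \<open>shifted, so that every index is in the range of the hypotheses\<close>
  define X where "X n = x (Suc n)" for n
  define s where "s n = x 1 \<bullet> X n" for n
  have X: "X n \<in> C" for n using inv by (simp add: X_def)
  have s_pos: "0 < s n" for n using inner_pos[OF assms(13) X] by (simp add: s_def)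
  have p_le: "x 1 \<bullet> p \<le> s n * (X n \<bullet> p)" for n
    using inv[of "Suc n"] Qs[of "Suc n" p] pF by (auto simp: s_def X_def)
  have XK: "X (Suc n) \<in> K (Suc n)" for n using proj(1)[of "Suc n"] inv by (simp add: X_def)
  have s_Suc: "s (Suc n) \<le> s n * (X n \<bullet> X (Suc n))" for n
    using XK[of n] Qs[of "Suc n" "X (Suc n)"] inv[of "Suc n"] by (auto simp: s_def X_def K_def)
  have c: "0 < x 1 \<bullet> p" using inner_pos assms(13) pC by blast
  have "decseq s"
  proof (rule decseq_SucI)
    show "s (Suc n) \<le> s n" for n
      using s_Suc[of n] s_pos[of n] inner_le_1[OF X X, of n "Suc n"]
        mult_left_le[of "X n \<bullet> X (Suc n)" "s n"] by linarith
  qed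
  moreover have s_ge: "x 1 \<bullet> p \<le> s n" for n
    using p_le[of n] s_pos[of n] inner_le_1[OF X pC, of n]
      mult_left_le[of "X n \<bullet> p" "s n"] by linarith
  ultimately obtain l where l: "s \<longlonglongrightarrow> l" "\<And>n. l \<le> s n"
    using decseq_convergent[of s "x 1 \<bullet> p"] by blast
  have l_ge: "x 1 \<bullet> p \<le> l" using LIMSEQ_le_const[OF l(1)] s_ge by blast
  then have l_pos: "0 < l" using c by linarith

  have "(\<lambda>n. s (Suc n) / s n) \<longlonglongrightarrow> l / l"
    using l(1) l_pos by (intro tendsto_divide LIMSEQ_Suc) auto
  then have ratio: "(\<lambda>n. 2 * sqrt (2 * (1 - s (Suc n) / s n))) \<longlonglongrightarrow> 2 * sqrt (2 * (1 - l / l))"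
    by (intro tendsto_mult tendsto_real_sqrt tendsto_diff tendsto_const)
  have "norm (y (Suc n) - X n) \<le> 2 * sqrt (2 * (1 - s (Suc n) / s n))" for n
  proof -
    define Y where "Y = y (Suc n)"
    have Y: "Y \<in> C" using yC[of "Suc n"] inv[of "Suc n"] by (simp add: Y_def)
    \<comment> \<open>both \<open>X n\<close> and \<open>Y\<close> are within the same small distance of \<open>X (Suc n)\<close>\<close>
    have near: "norm (u - X (Suc n)) \<le> sqrt (2 * (1 - s (Suc n) / s n))"
      if "u \<in> C" "X n \<bullet> X (Suc n) \<le> u \<bullet> X (Suc n)" for u
    proof (rule real_le_rsqrt)
      have "s (Suc n) / s n \<le> X n \<bullet> X (Suc n)"
        using s_Suc[of n] s_pos[of n] by (simp add: pos_divide_le_eq mult.commute)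
      then show "(norm (u - X (Suc n)))\<^sup>2 \<le> 2 * (1 - s (Suc n) / s n)"
        using that norm_diff_sphere[OF in_sphere in_sphere, of u "X (Suc n)"] X by simp
    qed
    have "X n \<bullet> X (Suc n) \<le> Y \<bullet> X (Suc n)"
      using XK[of n] Cs[of "Suc n" "X (Suc n)"] inv[of "Suc n"] by (auto simp: X_def K_def Y_def)
    from near[OF Y this] near[OF X[of n]] show ?thesis
      using norm_triangle_ineq[of "Y - X (Suc n)" "X (Suc n) - X n"]
      by (simp add: Y_def norm_minus_commute[of "X (Suc n)"])
  qed
  then have "(\<lambda>n. y (Suc n) - X n) \<longlonglongrightarrow> 0"
    by (rule Lim_null_comparison[OF always_eventually[OF allI]]) (use ratio l_pos in simp)
  moreover have "y (Suc n) = W_map T (\<alpha> (Suc n)) r (X n)" for n using y_eq by (simp add: X_def)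
  ultimately have W_reg: "(\<lambda>n. W_map T (\<alpha> (Suc n)) r (X n) - X n) \<longlonglongrightarrow> 0" by simp
  have pX: "x 1 \<bullet> p \<le> p \<bullet> X n" for n
  proof -
    have "s n * (X n \<bullet> p) \<le> 1 * (X n \<bullet> p)"
      using inner_le_1[OF assms(13) X] inner_pos[OF X pC, of n]
      by (intro mult_right_mono) (auto simp: s_def)
    then show ?thesis using p_le[of n] by (simp add: inner_commute)
  qed
  have T_reg: "(\<lambda>n. T i (X n) - X n) \<longlonglongrightarrow> 0" if "i \<in> {1..r}" for i
  proof (rule W_map_asymptotically_regular[where r = r and a = a and e = "x 1 \<bullet> p"
        and \<beta> = "\<lambda>n. \<alpha> (Suc n)"])
    show "p \<in> (\<Inter>i\<in>{1..r}. Fix C (T i))" using pF by (simp only: F_eq)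
  qed (use self nonexp assms(6) \<beta> X pC c pX W_reg that in simp_all)

  obtain q where q: "q \<in> C" "l \<le> x 1 \<bullet> q"
    "\<forall>N w. (\<forall>n\<ge>N. 0 \<le> w \<bullet> X n) \<longrightarrow> 0 \<le> w \<bullet> q"
    using tail_hull_point[of X "x 1" l] X assms(13) l_pos l(2) unfolding s_def by blast
  have "T i q = q" if "i \<in> {1..r}" for i
    using demiclosed[OF nonexp[OF that] self[OF that] X assms(13) l_pos _ q(1) q(3) T_reg[OF that]]
      l(2) by (simp add: s_def)
  then have qF: "q \<in> F" using q(1) by (simp add: F_eq Fix_def)
  have "l \<le> x 1 \<bullet> p"
    using q(2) p_max[OF qF] c inner_le_1[OF pC q(1)] mult_left_le[of "p \<bullet> q" "x 1 \<bullet> p"] by linarith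
  then have l_eq: "l = x 1 \<bullet> p" using l_ge by linarith
  have "(\<lambda>n. X n \<bullet> p) \<longlonglongrightarrow> 1"
  proof (rule tendsto_sandwich)
    show "(\<lambda>n. l / s n) \<longlonglongrightarrow> 1"
      using tendsto_divide[OF tendsto_const l(1), of l] l_pos by simp
    show "eventually (\<lambda>n. l / s n \<le> X n \<bullet> p) sequentially"
      using p_le s_pos by (simp add: l_eq pos_divide_le_eq mult.commute)
    show "eventually (\<lambda>n. X n \<bullet> p \<le> 1) sequentially" using inner_le_1[OF X pC] by simp
  qed simp
  then have "(\<lambda>n. arccos (X n \<bullet> p)) \<longlonglongrightarrow> arccos 1"
    using inner_sphere_bounds[OF in_sphere[OF X] in_sphere[OF pC]]
    by (intro continuous_on_tendsto_compose[OF continuous_on_arccos']) auto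
  then have "(\<lambda>n. sdist (X n) p) \<longlonglongrightarrow> 0"
    using in_sphere[OF X] in_sphere[OF pC] by (simp add: sdist_eq)
  then have "(\<lambda>n. sdist (x n) p) \<longlonglongrightarrow> 0" unfolding X_def by (rule LIMSEQ_imp_Suc)
  moreover have "eventually (\<lambda>n. x n \<in> sphere 0 1) sequentially"
    using inv in_sphere by (intro eventually_sequentiallyI[of 1]) blast
  ultimately have "limitin sph.mtopology x p sequentially"
    using in_sphere[OF pC] by (simp add: sph.limitin_metric_dist_null)
  with well_defined show ?thesis by (simp add: p_def)
qed

end
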